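(* Let $X$ be a Tychonoff space and let $I$ be an ideal in $C(X)$. Then the path component, the component and the quasi-component of the zero function $\underline{0}$ in $C_{m^I}(X)$ are all equal to $C_\psi(X)\cap I$.
   Context: $C(X)$ is the ring of all real-valued continuous functions on $X$; ideals may be improper. $Z(f)=\{x\in X:f(x)=0\}$. $C_\psi(X)$ is the ideal of all $f\in C(X)$ whose support $\operatorname{cl}_X(X\setminus Z(f))$ is pseudocompact. $C_+(X)$ is the set of strictly positive $u\in C(X)$. The $m^I$-topology on $C(X)$ has as base the sets $B_m(f,I,u)=\{g\in C(X):|f(x)-g(x)|<u(x)\ \forall x\in X,\ f-g\in I\}$, $f\in C(X)$, $u\in C_+(X)$; $C_{m^I}(X)$ is $C(X)$ with this topology. The quasi-component of a point is the intersection of all clopen sets containing it. *)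

theory Defs
  imports "HOL-Analysis.Analysis" "HOL-Algebra.Ideal"
begin

definition tychonoff_space :: "'a topology \<Rightarrow> bool" where
  "tychonoff_space X \<longleftrightarrow> completely_regular_space X \<and> Hausdorff_space X"

text \<open>A function on the space \<open>X\<close> is represented by the function on the whole type that is
  \<open>undefined\<close> off \<open>topspace X\<close>, so that equality in \<open>C(X)\<close> is equality of functions on
  \<open>topspace X\<close>.\<close>

definition C_ring :: "'a topology \<Rightarrow> ('a \<Rightarrow> real) ring" where
  "C_ring X =
     \<lparr>carrier = {f. continuous_map X euclideanreal f \<and> f \<in> extensional (topspace X)},
      mult = (\<lambda>f g. \<lambda>x\<in>topspace X. f x * g x),
      one = (\<lambda>x\<in>topspace X. 1),
      zero = (\<lambda>x\<in>topspace X. 0),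
      add = (\<lambda>f g. \<lambda>x\<in>topspace X. f x + g x)\<rparr>"

abbreviation C_space :: "'a topology \<Rightarrow> ('a \<Rightarrow> real) set" where
  "C_space X \<equiv> carrier (C_ring X)"

definition C_plus :: "'a topology \<Rightarrow> ('a \<Rightarrow> real) set" where
  "C_plus X = {u \<in> C_space X. \<forall>x\<in>topspace X. 0 < u x}"

definition pseudocompact_space :: "'a topology \<Rightarrow> bool" where
  "pseudocompact_space X \<longleftrightarrow>
     (\<forall>f. continuous_map X euclideanreal f \<longrightarrow> bounded (f ` topspace X))"

definition zero_set :: "'a topology \<Rightarrow> ('a \<Rightarrow> real) \<Rightarrow> 'a set" where
  "zero_set X f = {x \<in> topspace X. f x = 0}"

definition support_of :: "'a topology \<Rightarrow> ('a \<Rightarrow> real) \<Rightarrow> 'a set" where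
  "support_of X f = X closure_of (topspace X - zero_set X f)"

definition C_psi :: "'a topology \<Rightarrow> ('a \<Rightarrow> real) set" where
  "C_psi X = {f \<in> C_space X. pseudocompact_space (subtopology X (support_of X f))}"

definition B_m :: "'a topology \<Rightarrow> ('a \<Rightarrow> real) set \<Rightarrow> ('a \<Rightarrow> real) \<Rightarrow> ('a \<Rightarrow> real) \<Rightarrow> ('a \<Rightarrow> real) set" where
  "B_m X I f u = {g \<in> C_space X. (\<forall>x\<in>topspace X. \<bar>f x - g x\<bar> < u x) \<and>
                                 (\<lambda>x\<in>topspace X. f x - g x) \<in> I}"

definition mI_topology :: "'a topology \<Rightarrow> ('a \<Rightarrow> real) set \<Rightarrow> ('a \<Rightarrow> real) topology" where
  "mI_topology X I =
     topology (arbitrary union_of (\<lambda>B. \<exists>f \<in> C_space X. \<exists>u \<in> C_plus X. B = B_m X I f u))"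

lemma C_space_iff:
  "f \<in> C_space X \<longleftrightarrow> continuous_map X euclideanreal f \<and> f \<in> extensional (topspace X)"
  by (simp add: C_ring_def)

lemma restrict_in_C_space:
  assumes "continuous_map X euclideanreal f"
  shows "restrict f (topspace X) \<in> C_space X"
  using continuous_map_eq [OF assms, of "restrict f (topspace X)"] by (simp add: C_space_iff)

lemma ring_C_ring: "ring (C_ring X)"
proof -
  have c: "continuous_map X euclideanreal f" if "f \<in> C_space X" for f
    using that by (simp add: C_space_iff)
  have ext: "restrict f (topspace X) = f" if "f \<in> C_space X" for f
    using that by (simp add: C_space_iff extensional_restrict)
  have eqs: "mult (C_ring X) f g = (\<lambda>x\<in>topspace X. f x * g x)"
    "add (C_ring X) f g = (\<lambda>x\<in>topspace X. f x + g x)"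
    "one (C_ring X) = (\<lambda>x\<in>topspace X. 1)"
    "zero (C_ring X) = (\<lambda>x\<in>topspace X. 0)" for f g
    by (simp_all add: C_ring_def)
  show ?thesis
  proof (rule ringI)
    show "abelian_group (C_ring X)"
    proof (rule abelian_groupI)
      fix f assume f: "f \<in> C_space X"
      show "\<exists>g\<in>C_space X. g \<oplus>\<^bsub>C_ring X\<^esub> f = \<zero>\<^bsub>C_ring X\<^esub>"
        by (rule bexI [of _ "\<lambda>x\<in>topspace X. - f x"])
           (auto simp: eqs intro!: restrict_in_C_space continuous_map_minus c [OF f])
      show "\<zero>\<^bsub>C_ring X\<^esub> \<oplus>\<^bsub>C_ring X\<^esub> f = f"
        by (subst (2) ext [OF f, symmetric]) (auto simp: eqs intro!: restrict_ext)
    qed (auto simp: eqs intro!: restrict_in_C_space continuous_map_add restrict_ext intro: c)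
    show "monoid (C_ring X)"
    proof (rule monoidI)
      fix f assume f: "f \<in> C_space X"
      show "\<one>\<^bsub>C_ring X\<^esub> \<otimes>\<^bsub>C_ring X\<^esub> f = f" "f \<otimes>\<^bsub>C_ring X\<^esub> \<one>\<^bsub>C_ring X\<^esub> = f"
        by (subst (2) ext [OF f, symmetric], auto simp: eqs intro!: restrict_ext)+
    qed (auto simp: eqs intro!: restrict_in_C_space continuous_map_real_mult restrict_ext intro: c)
  qed (auto simp: eqs algebra_simps intro!: restrict_ext)
qed

text \<open>The sets \<open>B_m X I f u\<close> form a base, so \<open>topology\<close> above is applied to an actual
  topology; this is where \<open>I\<close> being closed under sums is needed.\<close>

lemma
  assumes I: "ideal I (C_ring X)"
  shows openin_mI_topology:
      "openin (mI_topology X I) =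
         arbitrary union_of (\<lambda>B. \<exists>f \<in> C_space X. \<exists>u \<in> C_plus X. B = B_m X I f u)" (is ?thesis1)
    and topspace_mI_topology: "topspace (mI_topology X I) = C_space X" (is ?thesis2)
proof -
  let ?P = "\<lambda>B. \<exists>f \<in> C_space X. \<exists>u \<in> C_plus X. B = B_m X I f u"
  interpret I: ideal I "C_ring X" by (rule I)
  have zero: "(\<lambda>x\<in>topspace X. 0) \<in> I"
    using additive_subgroup.zero_closed [OF I.is_additive_subgroup] by (simp add: C_ring_def)
  have add: "(\<lambda>x\<in>topspace X. f x + g x) \<in> I" if "f \<in> I" "g \<in> I" for f g
    using additive_subgroup.a_closed [OF I.is_additive_subgroup that] by (simp add: C_ring_def)
  have self: "h \<in> B_m X I h w" if "h \<in> C_space X" "w \<in> C_plus X" for h w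
    using that zero by (simp add: B_m_def C_plus_def)
  have mono: "B_m X I h w \<subseteq> B_m X I f u"
    if h: "h \<in> B_m X I f u" and w: "\<And>x. x \<in> topspace X \<Longrightarrow> w x \<le> u x - \<bar>f x - h x\<bar>" for f u h w
  proof
    fix k assume k: "k \<in> B_m X I h w"
    have "(\<lambda>x\<in>topspace X. (\<lambda>x\<in>topspace X. f x - h x) x + (\<lambda>x\<in>topspace X. h x - k x) x) \<in> I"
      by (rule add; use h k in \<open>simp only: B_m_def mem_Collect_eq\<close>)
    moreover have "(\<lambda>x\<in>topspace X. (\<lambda>x\<in>topspace X. f x - h x) x + (\<lambda>x\<in>topspace X. h x - k x) x)
                   = (\<lambda>x\<in>topspace X. f x - k x)"
      by (auto intro!: restrict_ext)
    moreover have "\<bar>f x - k x\<bar> < u x" if "x \<in> topspace X" for x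
    proof -
      have "\<bar>h x - k x\<bar> < w x" using k that by (simp add: B_m_def)
      with w [OF that] show ?thesis by linarith
    qed
    ultimately show "k \<in> B_m X I f u"
      using k by (simp add: B_m_def)
  qed
  have "(arbitrary union_of ?P) (B_m X I f u \<inter> B_m X I g v)"
    if "f \<in> C_space X" "u \<in> C_plus X" "g \<in> C_space X" "v \<in> C_plus X" for f u g v
  proof -
    have "\<exists>B. ?P B \<and> h \<in> B \<and> B \<subseteq> B_m X I f u \<inter> B_m X I g v"
      if h: "h \<in> B_m X I f u" "h \<in> B_m X I g v" for h
    proof -
      define w where "w = (\<lambda>x\<in>topspace X. min (u x - \<bar>f x - h x\<bar>) (v x - \<bar>g x - h x\<bar>))"
      have hC: "h \<in> C_space X"
        using h by (simp add: B_m_def)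
      have "w \<in> C_space X"
        unfolding w_def
        using hC \<open>f \<in> _\<close> \<open>u \<in> _\<close> \<open>g \<in> _\<close> \<open>v \<in> _\<close>
        by (intro restrict_in_C_space continuous_map_real_min continuous_map_diff
              continuous_map_real_abs) (auto simp: C_space_iff C_plus_def)
      moreover have "0 < w x" if "x \<in> topspace X" for x
        using h that by (auto simp: w_def B_m_def)
      ultimately have w: "w \<in> C_plus X"
        by (simp add: C_plus_def)
      have "B_m X I h w \<subseteq> B_m X I f u" "B_m X I h w \<subseteq> B_m X I g v"
        by (rule mono [OF h(1)], simp add: w_def) (rule mono [OF h(2)], simp add: w_def)
      then show ?thesis
        using hC w self by blast
    qed
    then show ?thesis
      by (subst arbitrary_union_of_alt) blast
  qed
  then have "istopology (arbitrary union_of ?P)"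
    by (subst istopology_base_eq) blast
  then show 1: ?thesis1
    by (simp add: mI_topology_def topology_inverse')
  have one: "(\<lambda>x\<in>topspace X. 1) \<in> C_plus X"
    by (auto simp: C_plus_def intro!: restrict_in_C_space)
  have "C_space X \<subseteq> topspace (mI_topology X I)"
  proof
    fix f assume f: "f \<in> C_space X"
    have "openin (mI_topology X I) (B_m X I f (\<lambda>x\<in>topspace X. 1))"
      unfolding 1 by (rule union_of_inc) (use f one in \<open>auto simp: arbitrary_def\<close>)
    from openin_subset [OF this] show "f \<in> topspace (mI_topology X I)"
      using self [OF f one] by blast
  qed
  moreover have "topspace (mI_topology X I) \<subseteq> C_space X"
  proof
    fix f assume "f \<in> topspace (mI_topology X I)"
    then have "\<exists>B. ?P B \<and> f \<in> B"
      using openin_topspace [of "mI_topology X I"] unfolding 1 arbitrary_union_of_alt by blast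
    then show "f \<in> C_space X"
      by (auto simp: B_m_def)
  qed
  ultimately show ?thesis2 by blast
qed

end

theory Submission
  imports Defs
begin

text \<open>If \<open>f \<in> I\<close> has pseudocompact support, then \<open>f/u\<close> is bounded for each positive unit \<open>u\<close>, so
  the segment \<open>t \<mapsto> t f\<close> is a path in the \<open>m\<^sup>I\<close>-topology. Conversely \<open>I\<close> is clopen, and so is
  \<open>{g. g/u is bounded}\<close> for each positive unit \<open>u\<close>. If the support of \<open>f\<close> is not pseudocompact,
  an unbounded continuous function on it yields a locally finite sequence of open subsets of the
  cozero set of \<open>f\<close>; a sum of bump functions in these sets gives \<open>u\<close> with \<open>f/u\<close> unbounded, and the
  corresponding clopen set separates \<open>0\<close> from \<open>f\<close>.\<close>

section \<open>Operations inside an ideal, and basic neighbourhoods in the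
  \<open>mI_topology\<close>\<close>

context
  fixes X :: "'a topology" and I :: "('a \<Rightarrow> real) set"
  assumes I: "ideal I (C_ring X)"
begin

lemma ideal_C_ring_diff:
  assumes "f \<in> I" "g \<in> I"
  shows "(\<lambda>x\<in>topspace X. f x - g x) \<in> I"
proof -
  interpret I: ideal I "C_ring X" by (rule I)
  have gC: "g \<in> C_space X"
    using I.a_subset assms by blast
  \<comment> \<open>Absorption of the constant \<open>-1\<close> gives negatives directly as
    pointwise functions, without identifying the additive inverse of the abstract ring.\<close>
  define m where "m = (\<lambda>x\<in>topspace X. - 1 :: real)"
  have "m \<in> C_space X"
    unfolding m_def by (intro restrict_in_C_space) simp
  then have "m \<otimes>\<^bsub>C_ring X\<^esub> g \<in> I"
    using I.I_l_closed assms by blast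
  then have "f \<oplus>\<^bsub>C_ring X\<^esub> (m \<otimes>\<^bsub>C_ring X\<^esub> g) \<in> I"
    using assms by (intro additive_subgroup.a_closed [OF I.is_additive_subgroup])
  also have "f \<oplus>\<^bsub>C_ring X\<^esub> (m \<otimes>\<^bsub>C_ring X\<^esub> g) = (\<lambda>x\<in>topspace X. f x - g x)"
    by (auto simp: C_ring_def m_def)
  finally show ?thesis .
qed

lemma ideal_C_ring_scale:
  assumes "f \<in> I"
  shows "(\<lambda>x\<in>topspace X. c * f x) \<in> I"
proof -
  interpret I: ideal I "C_ring X" by (rule I)
  have "(\<lambda>x\<in>topspace X. c) \<in> C_space X"
    by (intro restrict_in_C_space) simp
  then have "(\<lambda>x\<in>topspace X. c) \<otimes>\<^bsub>C_ring X\<^esub> f \<in> I"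
    using I.I_l_closed assms by blast
  also have "(\<lambda>x\<in>topspace X. c) \<otimes>\<^bsub>C_ring X\<^esub> f = (\<lambda>x\<in>topspace X. c * f x)"
    by (auto simp: C_ring_def)
  finally show ?thesis .
qed

lemma zero_in_ideal_C_ring: "(\<lambda>x\<in>topspace X. 0) \<in> I"
  using additive_subgroup.zero_closed [OF ideal.axioms(1) [OF I]] by (simp add: C_ring_def)

text \<open>Every ball lies in a single coset of \<open>I\<close>, whatever its radius; this is what
  makes \<open>I\<close> clopen.\<close>

lemma B_m_ideal_iff:
  assumes "f \<in> C_space X" "g \<in> B_m X I f u"
  shows "f \<in> I \<longleftrightarrow> g \<in> I"
proof -
  have d: "(\<lambda>x\<in>topspace X. f x - g x) \<in> I" and g: "g \<in> C_space X"
    using assms by (auto simp: B_m_def)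
  have "g = (\<lambda>x\<in>topspace X. f x - (\<lambda>x\<in>topspace X. f x - g x) x)"
    using g by (auto simp: C_space_iff extensional_def)
  then have 1: "g \<in> I" if "f \<in> I"
    using ideal_C_ring_diff [OF that d] by simp
  have "f = (\<lambda>x\<in>topspace X. g x - (\<lambda>x\<in>topspace X. -1 * (\<lambda>x\<in>topspace X. f x - g x) x) x)"
    using assms(1) by (auto simp: C_space_iff extensional_def)
  then have 2: "f \<in> I" if "g \<in> I"
    using ideal_C_ring_diff [OF that ideal_C_ring_scale [OF d, of "-1"]] by simp
  from 1 2 show ?thesis by blast
qed

lemma centre_in_B_m:
  assumes "f \<in> C_space X" "u \<in> C_plus X"
  shows "f \<in> B_m X I f u"
  using assms zero_in_ideal_C_ring by (simp add: B_m_def C_plus_def)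

text \<open>A base set containing \<open>h\<close> need not be centred at \<open>h\<close>, but by
  the triangle inequality the smaller radius \<open>u - \<bar>f - h\<bar>\<close> gives a ball
  around \<open>h\<close> inside it. Openness can thus be tested as in a metric space.\<close>

lemma openin_mI_topology_iff:
  "openin (mI_topology X I) U \<longleftrightarrow>
     U \<subseteq> C_space X \<and> (\<forall>f\<in>U. \<exists>u\<in>C_plus X. B_m X I f u \<subseteq> U)" (is "?L \<longleftrightarrow> ?R")
proof
  assume L: ?L
  then have "U \<subseteq> C_space X"
    using openin_subset topspace_mI_topology [OF I] by metis
  moreover have "\<exists>w\<in>C_plus X. B_m X I h w \<subseteq> U" if "h \<in> U" for h
  proof -
    from L that obtain f u where f: "f \<in> C_space X" and u: "u \<in> C_plus X"
      and h: "h \<in> B_m X I f u" and sub: "B_m X I f u \<subseteq> U"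
      unfolding openin_mI_topology [OF I] arbitrary_union_of_alt by blast
    have hC: "h \<in> C_space X"
      using h by (simp add: B_m_def)
    define w where "w = (\<lambda>x\<in>topspace X. u x - \<bar>f x - h x\<bar>)"
    have "w \<in> C_space X"
      unfolding w_def using f u hC
      by (intro restrict_in_C_space continuous_map_diff continuous_map_real_abs)
        (auto simp: C_space_iff C_plus_def)
    then have w: "w \<in> C_plus X"
      using h by (auto simp: C_plus_def w_def B_m_def)
    have "B_m X I h w \<subseteq> B_m X I f u"
    proof
      fix k assume k: "k \<in> B_m X I h w"
      have kC: "k \<in> C_space X"
        using k by (simp add: B_m_def)
      have "\<bar>f x - k x\<bar> < u x" if "x \<in> topspace X" for x
      proof -
        have "\<bar>h x - k x\<bar> < w x" using k that by (simp add: B_m_def)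
        then show ?thesis using that by (simp add: w_def)
      qed
      moreover have "(\<lambda>x\<in>topspace X. f x - h x) \<in> I" "(\<lambda>x\<in>topspace X. h x - k x) \<in> I"
        using h k by (simp_all add: B_m_def)
      from ideal_C_ring_diff [OF this(1) ideal_C_ring_scale [OF this(2), of "-1"]]
      have "(\<lambda>x\<in>topspace X. f x - k x) \<in> I"
        by (simp cong: restrict_cong)
      ultimately show "k \<in> B_m X I f u"
        using kC by (simp add: B_m_def)
    qed
    then show ?thesis
      using w sub by blast
  qed
  ultimately show ?R by blast
next
  assume ?R
  then show ?L
    unfolding openin_mI_topology [OF I] arbitrary_union_of_alt
    using centre_in_B_m by (metis subsetD)
qed

section \<open>Clopen sets and what they force on the quasi-component\<close>

text \<open>The radius \<open>u\<close> is the same for all centres, so a ball around a point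
  satisfying \<open>P\<close> stays in the set and a ball around any other point stays in the
  complement.\<close>

lemma clopen_mI_topology:
  assumes "u \<in> C_plus X"
    and "\<And>f g. f \<in> C_space X \<Longrightarrow> g \<in> B_m X I f u \<Longrightarrow> P f \<longleftrightarrow> P g"
  shows "openin (mI_topology X I) {f \<in> C_space X. P f}"
    and "closedin (mI_topology X I) {f \<in> C_space X. P f}"
proof -
  \<comment> \<open>\<open>Q\<close> will be the identity or negation, so one argument serves the
    set and its complement.\<close>
  have op: "openin (mI_topology X I) {f \<in> C_space X. Q (P f)}" for Q
    unfolding openin_mI_topology_iff
  proof (intro conjI ballI)
    fix f assume f: "f \<in> {f \<in> C_space X. Q (P f)}"
    have "B_m X I f u \<subseteq> {f \<in> C_space X. Q (P f)}"
    proof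
      fix g assume g: "g \<in> B_m X I f u"
      with assms(2) [of f g] f show "g \<in> {f \<in> C_space X. Q (P f)}"
        by (simp add: B_m_def)
    qed
    with assms(1) show "\<exists>u\<in>C_plus X. B_m X I f u \<subseteq> {f \<in> C_space X. Q (P f)}" by blast
  qed auto
  show "openin (mI_topology X I) {f \<in> C_space X. P f}"
    using op [of "\<lambda>p. p"] .
  have "C_space X - {f \<in> C_space X. P f} = {f \<in> C_space X. \<not> P f}" by blast
  then show "closedin (mI_topology X I) {f \<in> C_space X. P f}"
    using op [of Not] by (simp add: closedin_def topspace_mI_topology [OF I])
qed

lemma quasi_component_mI_topology_iff:
  assumes "quasi_component_of (mI_topology X I) f g" "u \<in> C_plus X"
    and "\<And>f g. f \<in> C_space X \<Longrightarrow> g \<in> B_m X I f u \<Longrightarrow> P f \<longleftrightarrow> P g"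
  shows "P f \<longleftrightarrow> P g"
proof -
  have "f \<in> C_space X" "g \<in> C_space X"
    using assms(1) by (auto simp: quasi_component_of_def topspace_mI_topology [OF I])
  moreover have "f \<in> {f \<in> C_space X. P f} \<longleftrightarrow> g \<in> {f \<in> C_space X. P f}"
    using assms(1) clopen_mI_topology [of u P, OF assms(2,3)] unfolding quasi_component_of_def by blast
  ultimately show ?thesis by simp
qed

lemma quasi_component_subset_ideal:
  assumes "quasi_component_of (mI_topology X I) \<zero>\<^bsub>C_ring X\<^esub> f"
  shows "f \<in> I"
proof -
  have "(\<lambda>x\<in>topspace X. 1) \<in> C_plus X"
    by (auto simp: C_plus_def intro!: restrict_in_C_space)
  from quasi_component_mI_topology_iff [OF assms this, of "\<lambda>f. f \<in> I"] show ?thesis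
    using B_m_ideal_iff zero_in_ideal_C_ring by (simp add: C_ring_def)
qed

lemma quasi_component_bounded_by_unit:
  assumes "quasi_component_of (mI_topology X I) \<zero>\<^bsub>C_ring X\<^esub> f" and u: "u \<in> C_plus X"
  obtains B where "\<And>x. x \<in> topspace X \<Longrightarrow> \<bar>f x\<bar> \<le> B * u x"
proof -
  define P where "P f \<longleftrightarrow> (\<exists>B. \<forall>x\<in>topspace X. \<bar>f x\<bar> \<le> B * u x)" for f :: "'a \<Rightarrow> real"
  have step: "P g" if Pf: "P f" and lt: "\<forall>x\<in>topspace X. \<bar>f x - g x\<bar> < u x" for f g
  proof -
    from Pf obtain B where B: "\<forall>x\<in>topspace X. \<bar>f x\<bar> \<le> B * u x"
      unfolding P_def by blast
    \<comment> \<open>A move by less than \<open>u\<close> costs at most one more multiple of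
      \<open>u\<close>; hence boundedness relative to \<open>u\<close> is constant on balls of
      radius \<open>u\<close>.\<close>
    have "\<bar>g x\<bar> \<le> (B + 1) * u x" if x: "x \<in> topspace X" for x
    proof -
      have "\<bar>f x\<bar> \<le> B * u x" "\<bar>f x - g x\<bar> < u x"
        using x B lt by auto
      then show ?thesis by (simp add: algebra_simps)
    qed
    then show ?thesis unfolding P_def by blast
  qed
  have "P f \<longleftrightarrow> P g" if "g \<in> B_m X I f u" for f g
    using that step [of f g] step [of g f] by (auto simp: B_m_def abs_minus_commute)
  with quasi_component_mI_topology_iff [OF assms, of P]
  have "P \<zero>\<^bsub>C_ring X\<^esub> \<longleftrightarrow> P f" by blast
  moreover have "P \<zero>\<^bsub>C_ring X\<^esub>"
    unfolding P_def by (rule exI [of _ 0]) (simp add: C_ring_def)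
  ultimately show ?thesis
    using that unfolding P_def by blast
qed

section \<open>The segment from zero to a function in \<open>C_psi X\<close> and
  \<open>I\<close>\<close>

text \<open>Pseudocompactness of the support bounds \<open>f / u\<close> there by some
  \<open>M\<close>, and \<open>f\<close> vanishes elsewhere. So parameters closer than
  \<open>1 / M\<close> give functions differing by less than \<open>u\<close>, and their difference
  is a multiple of \<open>f\<close>, hence in \<open>I\<close>.\<close>

lemma continuous_map_scale_mI_topology:
  assumes f: "f \<in> C_psi X" "f \<in> I"
  shows "continuous_map euclideanreal (mI_topology X I) (\<lambda>t. \<lambda>x\<in>topspace X. t * f x)"
    (is "continuous_map _ _ ?p")
proof -
  let ?S = "support_of X f"
  have fc: "continuous_map X euclideanreal f"
    and ps: "pseudocompact_space (subtopology X ?S)"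
    using f by (auto simp: C_psi_def C_space_iff)
  have S: "topspace (subtopology X ?S) = ?S"
    by (auto simp: support_of_def in_closure_of)
  have DS: "x \<in> ?S" if "x \<in> topspace X" "f x \<noteq> 0" for x
    using that closure_of_subset [of "topspace X - zero_set X f" X]
    by (auto simp: support_of_def zero_set_def)
  have pC: "?p t \<in> C_space X" for t
    by (intro restrict_in_C_space continuous_map_real_mult_left fc)
  have "\<exists>e>0. \<forall>s. dist s t < e \<longrightarrow> ?p s \<in> U"
    if U: "openin (mI_topology X I) U" "?p t \<in> U" for U t
  proof -
    obtain u where u: "u \<in> C_plus X" and sub: "B_m X I (?p t) u \<subseteq> U"
      using U by (auto simp: openin_mI_topology_iff)
    have upos: "u x > 0" if "x \<in> topspace X" for x
      using u that by (simp add: C_plus_def)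
    have "continuous_map X euclideanreal (\<lambda>x. f x / u x)"
      using u fc by (intro continuous_map_real_divide) (force simp: C_plus_def C_space_iff)+
    then have "continuous_map (subtopology X ?S) euclideanreal (\<lambda>x. f x / u x)"
      by (rule continuous_map_from_subtopology)
    then have "bounded ((\<lambda>x. f x / u x) ` ?S)"
      using ps S unfolding pseudocompact_space_def by metis
    then obtain M where M: "M > 0" "\<And>x. x \<in> ?S \<Longrightarrow> \<bar>f x / u x\<bar> \<le> M"
      unfolding bounded_pos by auto
    have "?p s \<in> B_m X I (?p t) u" if s: "dist s t < 1 / M" for s
    proof -
      have "\<bar>t * f x - s * f x\<bar> < u x" if x: "x \<in> topspace X" for x
      proof (cases "f x = 0")
        case False
        have fM: "\<bar>f x\<bar> \<le> M * u x"
          using M(2) [OF DS [OF x False]] upos [OF x] by (simp add: field_simps)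
        have st: "\<bar>t - s\<bar> * M < 1"
          using s M(1) by (simp add: dist_real_def field_simps abs_minus_commute)
        have "\<bar>t - s\<bar> * \<bar>f x\<bar> < u x"
        proof -
          have "\<bar>t - s\<bar> * \<bar>f x\<bar> \<le> \<bar>t - s\<bar> * (M * u x)"
            by (rule mult_left_mono) (use fM in auto)
          also have "\<dots> = (\<bar>t - s\<bar> * M) * u x"
            by simp
          also have "\<dots> < 1 * u x"
            by (rule mult_strict_right_mono) (use upos [OF x] st in auto)
          finally show ?thesis by simp
        qed
        then show ?thesis
          by (simp add: abs_mult flip: left_diff_distrib)
      qed (simp add: upos [OF x])
      moreover have "(\<lambda>x\<in>topspace X. ?p t x - ?p s x) = (\<lambda>x\<in>topspace X. (t - s) * f x)"
        by (auto simp: left_diff_distrib)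
      ultimately show ?thesis
        using pC ideal_C_ring_scale [OF f(2), of "t - s"] by (simp add: B_m_def)
    qed
    then show ?thesis
      using sub M(1) by (intro exI [of _ "1 / M"]) auto
  qed
  then show ?thesis
    using pC by (simp add: continuous_map topspace_mI_topology [OF I] open_dist image_subset_iff)
qed

lemma C_psi_ideal_subset_path_component:
  assumes f: "f \<in> C_psi X" "f \<in> I"
  shows "path_component_of (mI_topology X I) \<zero>\<^bsub>C_ring X\<^esub> f"
proof -
  let ?p = "\<lambda>t. \<lambda>x\<in>topspace X. t * f x"
  have "pathin (mI_topology X I) ?p"
    unfolding pathin_def
    by (intro continuous_map_from_subtopology continuous_map_scale_mI_topology f)
  moreover have "?p 0 = \<zero>\<^bsub>C_ring X\<^esub>"
    by (simp add: C_ring_def)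
  moreover have "?p 1 = f"
    using f by (simp add: C_psi_def C_space_iff extensional_restrict)
  ultimately show ?thesis
    unfolding path_component_of_def by blast
qed

end

section \<open>A positive function detecting a support that is not pseudocompact\<close>

text \<open>With \<open>G\<close> the sum of the bumps and \<open>u = 1 / (1 + G)\<close>, the
  quotient \<open>\<bar>f\<bar> / u = \<bar>f\<bar> * (1 + G)\<close> is at least \<open>n\<close>
  somewhere on each nonempty \<open>W n\<close>, and \<open>W n\<close> is nonempty for arbitrarily
  large \<open>n\<close>.\<close>

lemma not_pseudocompact_support_unbounded:
  assumes X: "completely_regular_space X" and fC: "f \<in> C_space X" and nf: "f \<notin> C_psi X"
  obtains u where "u \<in> C_plus X" "\<And>B. \<exists>x\<in>topspace X. B * u x < \<bar>f x\<bar>"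
proof -
  define S where "S = support_of X f"
  define D where "D = topspace X - zero_set X f"
  have S: "topspace (subtopology X S) = S" and Scl: "closedin X S"
    by (auto simp: S_def support_of_def in_closure_of)
  have fc: "continuous_map X euclideanreal f"
    using fC by (simp add: C_space_iff)
  have Deq: "D = {x \<in> topspace X. f x \<in> - {0}}"
    by (auto simp: D_def zero_set_def)
  have Dop: "openin X D"
    unfolding Deq by (intro openin_continuous_map_preimage [OF fc]) auto
  have DS: "D \<subseteq> S"
    unfolding D_def S_def support_of_def by (rule closure_of_subset) auto
  obtain h0 where h0: "continuous_map (subtopology X S) euclideanreal h0" "\<not> bounded (h0 ` S)"
    using nf fC S unfolding C_psi_def pseudocompact_space_def S_def by auto
  define h where "h x = \<bar>h0 x\<bar>" for x
  have hc: "continuous_map (subtopology X S) euclideanreal h"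
    unfolding h_def by (intro continuous_map_real_abs h0(1))
  have hcl: "closedin X {y \<in> S. h y \<in> K}" if "closed K" for K
    using closedin_continuous_map_preimage [OF hc, of K] that S closedin_trans_full Scl by fastforce
  \<comment> \<open>\<open>D\<close> is dense in \<open>S\<close>, so a bound for \<open>h\<close>
    on \<open>D\<close> would extend to the closed set \<open>S\<close>.\<close>
  have unb: "\<exists>x\<in>D. B < h x" for B
  proof (rule ccontr)
    assume "\<not> (\<exists>x\<in>D. B < h x)"
    then have "D \<subseteq> {y \<in> S. h y \<in> {..B}}"
      using DS by force
    from closure_of_minimal [OF this hcl] have "S \<subseteq> {y \<in> S. h y \<in> {..B}}"
      by (simp add: S_def D_def support_of_def)
    then have "bounded (h0 ` S)"
      by (auto simp: bounded_iff h_def)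
    with h0(2) show False ..
  qed
  \<comment> \<open>The bands overlap, so that they are open and still cover \<open>D\<close>: a
    point \<open>y\<close> lies in the band with index the floor of \<open>h y\<close>.\<close>
  define W where "W n = {x \<in> D. real n - 1 < h x \<and> h x < real n + 1}" for n
  have Wop: "openin X (W n)" for n
  proof -
    have "openin (subtopology X S) {x \<in> topspace (subtopology X S). h x \<in> {real n - 1<..<real n + 1}}"
      by (rule openin_continuous_map_preimage [OF hc]) simp
    then obtain V where V: "openin X V" "{x \<in> S. h x \<in> {real n - 1<..<real n + 1}} = V \<inter> S"
      unfolding S openin_subtopology by blast
    have "W n = D \<inter> V"
      using V(2) DS unfolding W_def by auto
    then show ?thesis
      using Dop V(1) by (simp add: openin_Int)
  qed
  have "\<exists>g. continuous_map X euclideanreal g \<and> (\<forall>x\<in>topspace X. 0 \<le> g x) \<and>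
          (\<forall>x\<in>topspace X - W n. g x = 0) \<and> (W n \<noteq> {} \<longrightarrow> (\<exists>x\<in>W n. real n \<le> \<bar>f x\<bar> * g x))" for n
  proof (cases "W n = {}")
    case True
    then show ?thesis by (intro exI [of _ "\<lambda>x. 0"]) auto
  next
    case False
    then obtain a where a: "a \<in> W n" by blast
    then have aX: "a \<in> topspace X" and fa: "f a \<noteq> 0"
      by (auto simp: W_def D_def zero_set_def)
    have "closedin X (topspace X - W n)"
      using Wop by blast
    then obtain b where b: "continuous_map X (top_of_set {0..1::real}) b" "b a = 0"
        "b ` (topspace X - W n) \<subseteq> {1}"
      using X a aX unfolding completely_regular_space_def by blast
    have bc: "continuous_map X euclideanreal b" and b01: "\<forall>x\<in>topspace X. b x \<in> {0..1}"
      using b(1) by (auto simp: continuous_map_in_subtopology)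
    \<comment> \<open>The factor makes \<open>\<bar>f\<bar> * g\<close> equal to \<open>n\<close> at
      \<open>a\<close>, where \<open>b\<close> is 0; off \<open>W n\<close>, \<open>b\<close> is 1
      and \<open>g\<close> vanishes.\<close>
    define g where "g x = real n / \<bar>f a\<bar> * (1 - b x)" for x
    have "continuous_map X euclideanreal g"
      unfolding g_def by (intro continuous_map_real_mult_left continuous_map_diff bc) auto
    moreover have "\<forall>x\<in>topspace X. 0 \<le> g x"
      using b01 by (auto simp: g_def)
    moreover have "\<forall>x\<in>topspace X - W n. g x = 0"
      using b(3) by (auto simp: g_def)
    moreover have "real n \<le> \<bar>f a\<bar> * g a"
      using fa b(2) by (simp add: g_def)
    ultimately show ?thesis using a by blast
  qed
  then obtain g where gc: "\<And>n. continuous_map X euclideanreal (g n)"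
    and g0: "\<And>n x. x \<in> topspace X \<Longrightarrow> 0 \<le> g n x"
    and gW: "\<And>n x. x \<in> topspace X \<Longrightarrow> x \<notin> W n \<Longrightarrow> g n x = 0"
    and gf: "\<And>n. W n \<noteq> {} \<Longrightarrow> \<exists>x\<in>W n. real n \<le> \<bar>f x\<bar> * g n x"
    by (metis DiffI)
  \<comment> \<open>On \<open>T N\<close> the terms \<open>g n\<close> with \<open>n > N\<close> vanish, so the infinite sum can be pasted together
    from its partial sums.\<close>
  define T where "T N = topspace X - {y \<in> S. h y \<in> {real N..}}" for N
  have Top: "openin X (T N)" for N
    unfolding T_def by (intro openin_diff hcl) auto
  have Tcov: "\<exists>N. x \<in> T N" if "x \<in> topspace X" for x
  proof -
    \<comment> \<open>Off \<open>S\<close> the value of \<open>h\<close> is arbitrary and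
      \<open>x\<close> lies in every \<open>T N\<close>; this choice covers both cases.\<close>
    obtain N where "h x < real N" using reals_Archimedean2 by blast
    then have "x \<in> T N" using that by (simp add: T_def)
    then show ?thesis ..
  qed
  have Tsum: "(\<Sum>n\<le>M. g n x) = (\<Sum>n\<le>N. g n x)" if "x \<in> T N" "N \<le> M" for x M N
  proof (rule sum.mono_neutral_right)
    show "\<forall>n\<in>{..M} - {..N}. g n x = 0"
    proof
      fix n assume "n \<in> {..M} - {..N}"
      \<comment> \<open>A point of \<open>W n\<close> lies in \<open>S\<close> and has
        \<open>h x > n - 1 \<ge> N\<close>, since \<open>n > N\<close>; on \<open>T N\<close> points
        of \<open>S\<close> have \<open>h x < N\<close>.\<close>
      then have "x \<notin> W n"
        using that(1) DS by (auto simp: T_def W_def)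
      then show "g n x = 0"
        using that(1) gW by (auto simp: T_def)
    qed
  qed (use that in auto)
  have agree: "(\<Sum>n\<le>M. g n x) = (\<Sum>n\<le>N. g n x)" if "x \<in> T M" "x \<in> T N" for x M N
    using Tsum [of x N M] Tsum [of x M N] that by (cases "N \<le> M") auto
  have "\<exists>G. continuous_map X euclideanreal G \<and>
          (\<forall>N. \<forall>x\<in>topspace X \<inter> T N. G x = (\<Sum>n\<le>N. g n x))"
  proof (rule pasting_lemma_exists [where X = X and I = UNIV and T = T and Y = euclideanreal
        and f = "\<lambda>N x. \<Sum>n\<le>N. g n x"])
    show "topspace X \<subseteq> (\<Union>N. T N)" using Tcov by blast
    show "openin X (T N)" for N by (rule Top)
    show "continuous_map (subtopology X (T N)) euclideanreal (\<lambda>x. \<Sum>n\<le>N. g n x)" for N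
      by (intro continuous_map_from_subtopology continuous_map_sum gc) auto
    show "(\<Sum>n\<le>M. g n x) = (\<Sum>n\<le>N. g n x)" if "x \<in> topspace X \<inter> T M \<inter> T N" for M N x
      by (rule agree) (use that in auto)
  qed blast
  then obtain G where G: "continuous_map X euclideanreal G"
    and GT: "\<And>x N. x \<in> topspace X \<Longrightarrow> x \<in> T N \<Longrightarrow> G x = (\<Sum>n\<le>N. g n x)"
    by blast
  have Gge: "g n x \<le> G x" if x: "x \<in> topspace X" for n x
  proof -
    obtain N where N: "x \<in> T N" using Tcov [OF x] by blast
    \<comment> \<open>Enlarging the index makes \<open>g n\<close> one of the nonnegative terms of
      the partial sum.\<close>
    have "T N \<subseteq> T (max n N)" by (auto simp: T_def)
    with N have "G x = (\<Sum>k\<le>max n N. g k x)" using GT x by blast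
    then show ?thesis
      using member_le_sum [of n "{..max n N}" "\<lambda>k. g k x"] g0 [OF x] by simp
  qed
  have G0: "0 \<le> G x" if "x \<in> topspace X" for x
    using Gge [OF that] g0 [OF that] order_trans by blast
  define u where "u = (\<lambda>x\<in>topspace X. 1 / (1 + G x))"
  have "u \<in> C_space X"
    unfolding u_def
    by (intro restrict_in_C_space continuous_map_real_divide continuous_map_add G)
      (use G0 in \<open>force+\<close>)
  then have "u \<in> C_plus X"
    using G0 by (auto simp: C_plus_def u_def intro: add_pos_nonneg)
  moreover have "\<exists>x\<in>topspace X. B * u x < \<bar>f x\<bar>" for B
  proof -
    \<comment> \<open>The extra 1 absorbs the loss from rounding \<open>h y\<close> down to
      \<open>n\<close>.\<close>
    obtain y where y: "y \<in> D" "\<bar>B\<bar> + 1 < h y" using unb by blast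
    define n where "n = nat \<lfloor>h y\<rfloor>"
    have "y \<in> W n" "\<bar>B\<bar> < real n"
      using y unfolding W_def n_def by (auto; linarith)+
    \<comment> \<open>\<open>y\<close> only shows that \<open>W n\<close> is nonempty; the large
      value of \<open>\<bar>f\<bar> * g n\<close> may occur at another point of the band.\<close>
    then obtain x where x: "x \<in> W n" "real n \<le> \<bar>f x\<bar> * g n x" using gf by blast
    then have xX: "x \<in> topspace X"
      by (simp add: W_def D_def)
    have "B < \<bar>f x\<bar> * g n x"
      using x(2) \<open>\<bar>B\<bar> < real n\<close> by linarith
    also have "\<dots> \<le> \<bar>f x\<bar> * (1 + G x)"
      using Gge [OF xX, of n] by (intro mult_left_mono) auto
    finally have "B * u x < \<bar>f x\<bar>"
      using G0 [OF xX] xX by (simp add: u_def field_simps)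
    with xX show ?thesis by blast
  qed
  ultimately show ?thesis using that by blast
qed

theorem theorem7p5:
  fixes X :: "'a topology" and I :: "('a \<Rightarrow> real) set"
  assumes "tychonoff_space X"
    and "ideal I (C_ring X)"
  shows "path_component_of_set (mI_topology X I) \<zero>\<^bsub>C_ring X\<^esub> = C_psi X \<inter> I \<and>
         connected_component_of_set (mI_topology X I) \<zero>\<^bsub>C_ring X\<^esub> = C_psi X \<inter> I \<and>
         quasi_component_of_set (mI_topology X I) \<zero>\<^bsub>C_ring X\<^esub> = C_psi X \<inter> I"
proof -
  let ?M = "mI_topology X I" and ?z = "\<zero>\<^bsub>C_ring X\<^esub>"
  \<comment> \<open>The inclusions form a cycle: quasi-component, \<open>C_psi X \<inter> I\<close>,
    path component, component, and back to the quasi-component. Hence all four sets are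
    equal.\<close>
  have "f \<in> C_psi X \<inter> I" if q: "quasi_component_of ?M ?z f" for f
  proof -
    have fC: "f \<in> C_space X"
      using q by (simp add: quasi_component_of_def topspace_mI_topology [OF assms(2)])
    have cr: "completely_regular_space X"
      using assms(1) by (simp add: tychonoff_space_def)
    have "f \<in> C_psi X"
    proof (rule ccontr)
      assume "f \<notin> C_psi X"
      then obtain u where u: "u \<in> C_plus X" "\<And>B. \<exists>x\<in>topspace X. B * u x < \<bar>f x\<bar>"
        using not_pseudocompact_support_unbounded [OF cr fC] by blast
      obtain B where "\<And>x. x \<in> topspace X \<Longrightarrow> \<bar>f x\<bar> \<le> B * u x"
        using quasi_component_bounded_by_unit [OF assms(2) q u(1)] by blast
      with u(2) [of B] show False by force
    qed
    then show ?thesis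
      using quasi_component_subset_ideal [OF assms(2) q] by blast
  qed
  moreover have "path_component_of ?M ?z f" if "f \<in> C_psi X \<inter> I" for f
    using C_psi_ideal_subset_path_component [OF assms(2)] that by blast
  moreover have "connected_component_of ?M ?z f" if "path_component_of ?M ?z f" for f
    using path_imp_connected_component_of that by metis
  moreover have "quasi_component_of ?M ?z f" if "connected_component_of ?M ?z f" for f
    using connected_imp_quasi_component_of that by metis
  ultimately show ?thesis by blast
qed

end
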